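(* Consider a GSWF on three alternatives with $n\ge1$ voters satisfying the IIA condition, where the choice functions $f,g,h:\{0,1\}^n\to\{0,1\}$ between the pairs of alternatives $(A,B)$, $(B,C)$ and $(C,A)$, respectively, are monotone increasing. If the distribution of the preferences is an even product distribution $D(\alpha,\beta,\gamma)$ satisfying $\alpha,\beta,\gamma\le1/4$ (in particular, if the preferences are uniformly distributed, $\alpha=\beta=\gamma=1/6$), then the probability $W(f,g,h)$ of an irrational choice satisfies $$W(f,g,h)\le p_1p_2p_3+(1-p_1)(1-p_2)(1-p_3),$$ where $p_1,p_2,p_3$ are the expectations of $f,g,h$, respectively, with respect to the uniform measure on $\{0,1\}^n$.
   Context: There are $n$ voters and three alternatives $A,B,C$. Each voter gives a strict linear ordering of the alternatives; a profile is the collection of the $n$ orderings. Voter $i$'s ordering is encoded by $(x_i,y_i,z_i)\in\{0,1\}^3\setminus\{(0,0,0),(1,1,1)\}$, where $x_i=1$ iff voter $i$ prefers $A$ to $B$, $y_i=1$ iff voter $i$ prefers $B$ to $C$, and $z_i=1$ iff voter $i$ prefers $C$ to $A$. A generalized social welfare function (GSWF) assigns to each profile a preference of the society on each of the three pairs of alternatives (not necessarily transitive). It satisfies Independence of Irrelevant Alternatives (IIA) if the society's preference on each pair depends only on the individual preferences on that pair; so it is given by choice functions $f,g,h:\{0,1\}^n\to\{0,1\}$: society prefers $A$ to $B$ iff $f(x)=1$, $B$ to $C$ iff $g(y)=1$, and $C$ to $A$ iff $h(z)=1$. The choice of the society is irrational for a profile if $f(x)=g(y)=h(z)=1$ or $f(x)=g(y)=h(z)=0$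 (no linear ordering results), and rational otherwise. Even product distribution $D(\alpha,\beta,\gamma)$ ($\alpha,\beta,\gamma\ge0$, $\alpha+\beta+\gamma=1/2$): the triples $(x_i,y_i,z_i)$ are independent for different $i$, and for each $i$, $\Pr[(1,1,0)]=\Pr[(0,0,1)]=\alpha$, $\Pr[(0,1,1)]=\Pr[(1,0,0)]=\beta$, $\Pr[(1,0,1)]=\Pr[(0,1,0)]=\gamma$. A function $f$ on $\{0,1\}^n$ is monotone increasing if $f(x)\le f(y)$ whenever $x_i\le y_i$ for all $i$. *)

theory Defs
  imports "HOL-Probability.Probability"
begin

datatype alternative = AltA | AltB | AltC

(* A pair (a, b) in a preference relation means that a is preferred to b.
   Voters form a nonempty finite type 'v, so n = CARD('v) >= 1 is arbitrary. *)

type_synonym preference = "alternative rel"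

type_synonym 'v profile = "'v \<Rightarrow> preference"

definition profiles :: "'v profile set" where
  "profiles = {P. \<forall>i. strict_linear_order_on UNIV (P i)}"

(* x_i for the pair (A,B), y_i for (B,C), z_i for (C,A) *)
definition votes :: "alternative \<Rightarrow> alternative \<Rightarrow> 'v profile \<Rightarrow> 'v \<Rightarrow> bool" where
  "votes a b P = (\<lambda>i. (a, b) \<in> P i)"

(* Society prefers exactly one alternative of each pair; transitivity is not required. *)
definition gswf :: "('v profile \<Rightarrow> preference) \<Rightarrow> bool" where
  "gswf F \<longleftrightarrow> (\<forall>P\<in>profiles. asym (F P) \<and> total (F P))"

definition IIA :: "('v profile \<Rightarrow> preference) \<Rightarrow> bool" where
  "IIA F \<longleftrightarrow> (\<forall>a b. \<forall>P\<in>profiles. \<forall>Q\<in>profiles.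
     votes a b P = votes a b Q \<longrightarrow> ((a, b) \<in> F P \<longleftrightarrow> (a, b) \<in> F Q))"

definition choice_function ::
  "('v profile \<Rightarrow> preference) \<Rightarrow> alternative \<Rightarrow> alternative \<Rightarrow> (('v \<Rightarrow> bool) \<Rightarrow> bool) \<Rightarrow> bool" where
  "choice_function F a b f \<longleftrightarrow> (\<forall>P\<in>profiles. (a, b) \<in> F P \<longleftrightarrow> f (votes a b P))"

definition irrational :: "preference \<Rightarrow> bool" where
  "irrational R \<longleftrightarrow>
     ((AltA, AltB) \<in> R \<and> (AltB, AltC) \<in> R \<and> (AltC, AltA) \<in> R) \<or>
     ((AltA, AltB) \<notin> R \<and> (AltB, AltC) \<notin> R \<and> (AltC, AltA) \<notin> R)"

fun preference_of :: "bool \<times> bool \<times> bool \<Rightarrow> preference" where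
  "preference_of (x, y, z) =
     {if x then (AltA, AltB) else (AltB, AltA),
      if y then (AltB, AltC) else (AltC, AltB),
      if z then (AltC, AltA) else (AltA, AltC)}"

(* pmf_of_list is meaningful only for nonnegative weights of total mass 1,
   i.e. for alpha, beta, gamma >= 0 with alpha + beta + gamma = 1/2; see even_triple_wf. *)
definition even_triple_list :: "real \<Rightarrow> real \<Rightarrow> real \<Rightarrow> ((bool \<times> bool \<times> bool) \<times> real) list" where
  "even_triple_list \<alpha> \<beta> \<gamma> =
     [((True, True, False), \<alpha>), ((False, False, True), \<alpha>),
      ((False, True, True), \<beta>), ((True, False, False), \<beta>),
      ((True, False, True), \<gamma>), ((False, True, False), \<gamma>)]"

definition even_product :: "real \<Rightarrow> real \<Rightarrow> real \<Rightarrow> ('v::finite) profile pmf" where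
  "even_product \<alpha> \<beta> \<gamma> =
     Pi_pmf UNIV undefined
       (\<lambda>_. map_pmf preference_of (pmf_of_list (even_triple_list \<alpha> \<beta> \<gamma>)))"

definition irrational_prob ::
  "real \<Rightarrow> real \<Rightarrow> real \<Rightarrow> (('v::finite) profile \<Rightarrow> preference) \<Rightarrow> real" where
  "irrational_prob \<alpha> \<beta> \<gamma> F =
     measure_pmf.prob (even_product \<alpha> \<beta> \<gamma>) {P. irrational (F P)}"

definition uniform_mean :: "(('v::finite \<Rightarrow> bool) \<Rightarrow> bool) \<Rightarrow> real" where
  "uniform_mean f = measure_pmf.expectation (pmf_of_set UNIV) (\<lambda>x. of_bool (f x))"

lemma all_alternative: "(\<forall>a. Q a) \<longleftrightarrow> Q AltA \<and> Q AltB \<and> Q AltC"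
  by (metis alternative.exhaust)

lemma strict_linear_order_preference_of_iff:
  "strict_linear_order_on UNIV (preference_of t) \<longleftrightarrow>
     t \<notin> {(False, False, False), (True, True, True)}"
proof -
  obtain x y z where t: "t = (x, y, z)" by (cases t)
  show ?thesis
    unfolding t strict_linear_order_on_def trans_def irrefl_def total_on_def all_alternative
    by (cases x; cases y; cases z) (simp_all add: all_alternative)
qed

lemma preference_of_encoding:
  assumes "asym R" "total R"
  shows "preference_of ((AltA, AltB) \<in> R, (AltB, AltC) \<in> R, (AltC, AltA) \<in> R) = R"
proof -
  have irr: "(a, a) \<notin> R" for a
    using assms(1) by (meson asymD)
  have flip: "a \<noteq> b \<Longrightarrow> (b, a) \<in> R \<longleftrightarrow> (a, b) \<notin> R" for a b
    using assms(1) assms(2) unfolding total_on_def by (meson UNIV_I asymD)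
  have [simp]: "(AltB, AltA) \<in> R \<longleftrightarrow> (AltA, AltB) \<notin> R"
    "(AltC, AltB) \<in> R \<longleftrightarrow> (AltB, AltC) \<notin> R"
    "(AltA, AltC) \<in> R \<longleftrightarrow> (AltC, AltA) \<notin> R"
    by (rule flip, simp)+
  have "(a, b) \<in> preference_of ((AltA, AltB) \<in> R, (AltB, AltC) \<in> R, (AltC, AltA) \<in> R)
      \<longleftrightarrow> (a, b) \<in> R" for a b
    by (cases a; cases b) (simp_all add: irr)
  then show ?thesis by (simp only: set_eq_iff split_paired_all) simp
qed

lemma irrational_iff_not_linear:
  assumes "asym R" "total R"
  shows "irrational R \<longleftrightarrow> \<not> strict_linear_order_on UNIV R"
  using strict_linear_order_preference_of_iff
      [of "((AltA, AltB) \<in> R, (AltB, AltC) \<in> R, (AltC, AltA) \<in> R)"]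
  unfolding preference_of_encoding[OF assms] irrational_def by simp blast

lemma irrational_iff_choice:
  assumes "P \<in> profiles" "choice_function F AltA AltB f"
    "choice_function F AltB AltC g" "choice_function F AltC AltA h"
  shows "irrational (F P) \<longleftrightarrow>
    f (votes AltA AltB P) = g (votes AltB AltC P) \<and> g (votes AltB AltC P) = h (votes AltC AltA P)"
proof -
  have "(AltA, AltB) \<in> F P \<longleftrightarrow> f (votes AltA AltB P)"
    "(AltB, AltC) \<in> F P \<longleftrightarrow> g (votes AltB AltC P)"
    "(AltC, AltA) \<in> F P \<longleftrightarrow> h (votes AltC AltA P)"
    using assms unfolding choice_function_def by blast+
  then show ?thesis unfolding irrational_def by argo
qed

lemma even_triple_wf:
  assumes "\<alpha> \<ge> 0" "\<beta> \<ge> 0" "\<gamma> \<ge> 0" "\<alpha> + \<beta> + \<gamma> = 1/2"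
  shows "pmf_of_list_wf (even_triple_list \<alpha> \<beta> \<gamma>)"
  using assms by (auto simp: pmf_of_list_wf_def even_triple_list_def)

lemma set_even_product:
  assumes "\<alpha> \<ge> 0" "\<beta> \<ge> 0" "\<gamma> \<ge> 0" "\<alpha> + \<beta> + \<gamma> = 1/2"
  shows "set_pmf (even_product \<alpha> \<beta> \<gamma>) \<subseteq> profiles"
proof
  fix P :: "('v::finite) profile" assume "P \<in> set_pmf (even_product \<alpha> \<beta> \<gamma>)"
  then have P: "P i \<in> preference_of ` set_pmf (pmf_of_list (even_triple_list \<alpha> \<beta> \<gamma>))" for i
    by (auto simp: even_product_def set_Pi_pmf PiE_dflt_def)
  have sub: "set_pmf (pmf_of_list (even_triple_list \<alpha> \<beta> \<gamma>))
      \<subseteq> set (map fst (even_triple_list \<alpha> \<beta> \<gamma>))"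
    by (rule set_pmf_of_list[OF even_triple_wf[OF assms]])
  have "strict_linear_order_on UNIV (P i)" for i
  proof -
    obtain t where t: "P i = preference_of t" "t \<in> set_pmf (pmf_of_list (even_triple_list \<alpha> \<beta> \<gamma>))"
      using P[of i] by (rule imageE)
    have "t \<in> set (map fst (even_triple_list \<alpha> \<beta> \<gamma>))"
      by (rule subsetD[OF sub t(2)])
    then have "t \<notin> {(False, False, False), (True, True, True)}"
      by (auto simp: even_triple_list_def)
    then show ?thesis
      by (simp only: t(1) strict_linear_order_preference_of_iff not_False_eq_True)
  qed
  then show "P \<in> profiles"
    by (simp add: profiles_def)
qed

end

theory Submission
  imports Defs
begin

text \<open>
  The cubic terms in \<open>f g h + (1 - f) (1 - g) (1 - h)\<close> cancel, so the claim reduces to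
  negative correlation of any two of the three choice functions. The votes of one voter on two
  pairs are fair coins that are both 1 with probability at most \<open>1/4\<close>, hence negatively
  correlated; monotone functions of them inherit this by induction on the set of voters,
  conditioning on the vote of one voter at a time.
\<close>

text \<open>A function on \<open>bool\<close> is affine in the truth value, so the covariance of
  \<phi> and \<psi> is the product of their slopes times the covariance of the two bits.
  Monotonicity makes the slopes nonnegative, and \<open>q\<close> makes the covariance of the bits
  nonpositive.\<close>

lemma expectation_mult_bool_le:
  fixes q :: "(bool \<times> bool) pmf" and \<phi> \<psi> :: "bool \<Rightarrow> real"
  assumes q: "pmf q (True, True) \<le>
      measure_pmf.prob q {t. fst t} * measure_pmf.prob q {t. snd t}"
    and "mono \<phi>" "mono \<psi>"
  shows "measure_pmf.expectation q (\<lambda>t. \<phi> (fst t) * \<psi> (snd t)) \<le>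
    measure_pmf.expectation q (\<lambda>t. \<phi> (fst t)) * measure_pmf.expectation q (\<lambda>t. \<psi> (snd t))"
proof -
  have affine: "\<theta> b = \<theta> False + (\<theta> True - \<theta> False) * of_bool b" for \<theta> :: "bool \<Rightarrow> real" and b
    by (cases b) auto
  have E: "measure_pmf.expectation q k = k (True, True) * pmf q (True, True) +
      k (True, False) * pmf q (True, False) + k (False, True) * pmf q (False, True) +
      k (False, False) * pmf q (False, False)" for k :: "bool \<times> bool \<Rightarrow> real"
    by (subst integral_measure_pmf_real[of UNIV]) (auto simp: UNIV_Times_UNIV[symmetric] UNIV_bool
        simp del: UNIV_Times_UNIV)
  define a b c d where "a = pmf q (True, True)" "b = pmf q (True, False)"
    "c = pmf q (False, True)" "d = pmf q (False, False)"
  have total: "a + b + c + d = 1"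
    using E[of "\<lambda>_. 1"] by (simp add: a_b_c_d_def)
  have "measure_pmf.prob q {t. fst t} = a + b"
    using E[of "indicator {t. fst t}"] by (simp add: a_b_c_d_def)
  moreover have "measure_pmf.prob q {t. snd t} = a + c"
    using E[of "indicator {t. snd t}"] by (simp add: a_b_c_d_def)
  ultimately have corr: "a \<le> (a + b) * (a + c)"
    using q by (simp add: a_b_c_d_def)
  have "0 \<le> (\<phi> True - \<phi> False) * (\<psi> True - \<psi> False) * ((a + b) * (a + c) - a)"
    using assms(2,3) corr by (intro mult_nonneg_nonneg) (auto simp: mono_def)
  \<comment> \<open>A polynomial identity modulo \<open>a + b + c + d = 1\<close>.\<close>
  also have "\<dots> = measure_pmf.expectation q (\<lambda>t. \<phi> (fst t)) * measure_pmf.expectation q (\<lambda>t. \<psi> (snd t))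
      - measure_pmf.expectation q (\<lambda>t. \<phi> (fst t) * \<psi> (snd t))"
    unfolding E using total by (simp add: a_b_c_d_def[symmetric]) algebra
  finally show ?thesis by simp
qed

lemma finite_set_Pi_pmf:
  fixes p :: "'i \<Rightarrow> 'a::finite pmf"
  assumes "finite A"
  shows "finite (set_pmf (Pi_pmf A d p))"
  using assms by (simp add: set_Pi_pmf finite_PiE_dflt)

text \<open>The law of total expectation, conditioning on coordinate \<open>i\<close>. The finite
  value type keeps all supports finite.\<close>

lemma expectation_Pi_pmf_insert:
  fixes p :: "'i \<Rightarrow> 'a::finite pmf" and k :: "('i \<Rightarrow> 'a) \<Rightarrow> real"
  assumes "finite A" "i \<notin> A"
  shows "measure_pmf.expectation (Pi_pmf (insert i A) d p) k =
    measure_pmf.expectation (p i)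
      (\<lambda>t. measure_pmf.expectation (Pi_pmf A d p) (\<lambda>w. k (w(i := t))))"
  unfolding Pi_pmf_insert'[OF assms] map_pmf_def[symmetric]
  by (subst pmf_expectation_bind[of UNIV])
    (auto simp: integral_measure_pmf_real[of UNIV] assms finite_set_Pi_pmf mult.commute)

text \<open>Given the pair \<open>t\<close> of coordinate \<open>i\<close>, the induction hypothesis
  bounds the mean of the product by a function of \<open>fst t\<close> times a function of
  \<open>snd t\<close>. Both functions are again monotone, so the one-coordinate inequality
  finishes. The induction generalizes \<open>f\<close> and \<open>g\<close> because freezing a
  coordinate changes them.\<close>

lemma expectation_Pi_pmf_mult_le:
  fixes p :: "'i \<Rightarrow> (bool \<times> bool) pmf" and f g :: "('i \<Rightarrow> bool) \<Rightarrow> real"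
  assumes "finite A"
    and corr: "\<And>i. i \<in> A \<Longrightarrow> pmf (p i) (True, True) \<le>
      measure_pmf.prob (p i) {t. fst t} * measure_pmf.prob (p i) {t. snd t}"
    and "mono f" "mono g"
  shows "measure_pmf.expectation (Pi_pmf A d p) (\<lambda>w. f (fst \<circ> w) * g (snd \<circ> w)) \<le>
    measure_pmf.expectation (Pi_pmf A d p) (\<lambda>w. f (fst \<circ> w)) *
    measure_pmf.expectation (Pi_pmf A d p) (\<lambda>w. g (snd \<circ> w))"
  using assms
proof (induction A arbitrary: f g rule: finite_induct)
  case empty
  then show ?case by simp
next
  case (insert i A)
  let ?E = "measure_pmf.expectation (Pi_pmf A d p)"
  \<comment> \<open>The conditional mean of \<open>f\<close> given the first bit of coordinate
    \<open>i\<close>; the second bit is irrelevant to it because \<open>f\<close> reads first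
    components only. Symmetrically for \<psi>.\<close>
  define \<phi> where "\<phi> b = ?E (\<lambda>w. f ((fst \<circ> w)(i := b)))" for b
  define \<psi> where "\<psi> b = ?E (\<lambda>w. g ((snd \<circ> w)(i := b)))" for b
  have int: "integrable (measure_pmf (Pi_pmf A d p)) k" for k :: "_ \<Rightarrow> real"
    using insert.hyps(1) by (intro integrable_measure_pmf_finite finite_set_Pi_pmf)
  have mono_upd: "mono (\<lambda>x. k (x(i := b)))" if "mono k" for k :: "('i \<Rightarrow> bool) \<Rightarrow> real" and b
    using that by (auto simp: mono_def le_fun_def)
  have mono_E: "mono (\<lambda>b. ?E (\<lambda>w. k ((r \<circ> w)(i := b))))"
    if "mono k" for k :: "('i \<Rightarrow> bool) \<Rightarrow> real" and r
    using that by (intro monoI integral_mono int) (auto simp: mono_def le_fun_def)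
  have "measure_pmf.expectation (Pi_pmf (insert i A) d p) (\<lambda>w. f (fst \<circ> w) * g (snd \<circ> w)) =
      measure_pmf.expectation (p i) (\<lambda>t. ?E (\<lambda>w. f ((fst \<circ> w)(i := fst t)) * g ((snd \<circ> w)(i := snd t))))"
    by (simp add: expectation_Pi_pmf_insert insert.hyps fun_upd_comp)
  also have "\<dots> \<le> measure_pmf.expectation (p i) (\<lambda>t. \<phi> (fst t) * \<psi> (snd t))"
    unfolding \<phi>_def \<psi>_def
    by (intro integral_mono integrable_measure_pmf_finite insert.IH mono_upd insert.prems) auto
  also have "\<dots> \<le> measure_pmf.expectation (p i) (\<lambda>t. \<phi> (fst t)) *
      measure_pmf.expectation (p i) (\<lambda>t. \<psi> (snd t))"
    unfolding \<phi>_def \<psi>_def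
    by (intro expectation_mult_bool_le insert.prems mono_E) auto
  also have "\<dots> = measure_pmf.expectation (Pi_pmf (insert i A) d p) (\<lambda>w. f (fst \<circ> w)) *
      measure_pmf.expectation (Pi_pmf (insert i A) d p) (\<lambda>w. g (snd \<circ> w))"
    by (simp add: expectation_Pi_pmf_insert insert.hyps fun_upd_comp \<phi>_def \<psi>_def)
  finally show ?case .
qed

lemma Pi_pmf_coin: "Pi_pmf UNIV d (\<lambda>_::'v::finite. pmf_of_set (UNIV :: bool set)) = pmf_of_set UNIV"
  by (subst Pi_pmf_of_set) (auto simp: PiE_dflt_def)

text \<open>Applying \<open>u\<close> coordinatewise turns the product of copies of \<open>p\<close>
  into a product of fair coins, which is the uniform measure. This is why uniform means appear in
  the bound whatever the even product distribution.\<close>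

lemma expectation_fair_votes:
  fixes f :: "('v::finite \<Rightarrow> bool) \<Rightarrow> bool"
  assumes "map_pmf u p = pmf_of_set UNIV"
  shows "measure_pmf.expectation (Pi_pmf UNIV d (\<lambda>_. p)) (\<lambda>P. of_bool (f (u \<circ> P))) = uniform_mean f"
proof -
  \<comment> \<open>Pushing \<open>u\<close> through the product turns the default \<open>d\<close>
    into \<open>u d\<close>.\<close>
  have "map_pmf (\<lambda>P. u \<circ> P) (Pi_pmf UNIV d (\<lambda>_::'v. p)) = pmf_of_set UNIV"
    by (subst Pi_pmf_map[symmetric, where dflt' = "u d"]) (simp_all add: assms Pi_pmf_coin)
  then show ?thesis
    unfolding uniform_mean_def
    using integral_map_pmf[of "\<lambda>P. u \<circ> P" "Pi_pmf UNIV d (\<lambda>_. p)" "\<lambda>x. of_bool (f x) :: real"]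
    by simp
qed

text \<open>Two fair coins have product of marginals \<open>1/4\<close>, so \<open>uv\<close> says
  exactly that they are not positively correlated. Mapping each voter to the pair of bits
  \<open>(u t, v t)\<close> gives the setting of \<open>expectation_Pi_pmf_mult_le\<close>.\<close>

lemma expectation_fair_votes_mult_le:
  fixes f g :: "('v::finite \<Rightarrow> bool) \<Rightarrow> bool"
  assumes u: "map_pmf u p = pmf_of_set UNIV" and v: "map_pmf v p = pmf_of_set UNIV"
    and uv: "measure_pmf.prob p {t. u t \<and> v t} \<le> 1/4"
    and "mono f" "mono g"
  shows "measure_pmf.expectation (Pi_pmf UNIV d (\<lambda>_. p))
      (\<lambda>P. of_bool (f (u \<circ> P)) * of_bool (g (v \<circ> P))) \<le> uniform_mean f * uniform_mean g"
proof -
  let ?r = "\<lambda>t. (u t, v t)"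
  let ?E = "measure_pmf.expectation (Pi_pmf UNIV (?r d) (\<lambda>_::'v. map_pmf ?r p))"
  have fst: "map_pmf fst (map_pmf ?r p) = pmf_of_set UNIV"
    and snd: "map_pmf snd (map_pmf ?r p) = pmf_of_set UNIV"
    using u v by (simp_all add: pmf.map_comp comp_def)
  have half: "measure_pmf.prob (map_pmf ?r p) {t. w t} = 1/2"
    if "map_pmf w (map_pmf ?r p) = pmf_of_set UNIV" for w
  proof -
    have "measure_pmf.prob (map_pmf w (map_pmf ?r p)) {True} = 1/2"
      unfolding that by (simp add: measure_pmf_of_set)
    then show ?thesis by (simp add: vimage_def)
  qed
  have "pmf (map_pmf ?r p) (True, True) = measure_pmf.prob p {t. u t \<and> v t}"
    by (simp add: pmf_map vimage_def)
  then have corr: "pmf (map_pmf ?r p) (True, True) \<le>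
      measure_pmf.prob (map_pmf ?r p) {t. fst t} * measure_pmf.prob (map_pmf ?r p) {t. snd t}"
    using uv unfolding half[OF fst] half[OF snd] by simp
  have mono: "mono (\<lambda>x. of_bool (k x) :: real)" if "mono k" for k :: "('v \<Rightarrow> bool) \<Rightarrow> bool"
    using that by (auto simp: mono_def)
  have "?E (\<lambda>w. of_bool (f (fst \<circ> w)) * of_bool (g (snd \<circ> w))) \<le>
      ?E (\<lambda>w. of_bool (f (fst \<circ> w))) * (?E (\<lambda>w. of_bool (g (snd \<circ> w))) :: real)"
    by (rule expectation_Pi_pmf_mult_le[of _ _ "\<lambda>x. of_bool (f x)" "\<lambda>x. of_bool (g x)"])
      (simp_all only: finite_class.finite_UNIV corr mono assms)
  also have "\<dots> = uniform_mean f * uniform_mean g"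
    by (simp only: expectation_fair_votes fst snd)
  also have "?E (\<lambda>w. of_bool (f (fst \<circ> w)) * of_bool (g (snd \<circ> w))) =
      measure_pmf.expectation (Pi_pmf UNIV d (\<lambda>_. p))
        (\<lambda>P. of_bool (f (u \<circ> P)) * of_bool (g (v \<circ> P)) :: real)"
    by (subst Pi_pmf_map[of _ _ d]) (simp_all add: comp_def)
  finally show ?thesis .
qed

lemma map_pmf_eq_fair_coinI:
  assumes "measure_pmf.prob p {t. u t} = 1/2"
  shows "map_pmf u p = pmf_of_set (UNIV :: bool set)"
proof (rule pmf_eqI)
  fix b
  have "measure_pmf.prob p {t. \<not> u t} = 1/2"
    using measure_pmf.prob_compl[of "{t. u t}" p] assms by (simp add: Collect_neg_eq Compl_eq_Diff_UNIV)
  then show "pmf (map_pmf u p) b = pmf (pmf_of_set UNIV) b"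
    using assms by (cases b) (simp_all add: pmf_map vimage_def)
qed

theorem theorem4p2:
  fixes F :: "('v::finite) profile \<Rightarrow> preference"
    and f g h :: "('v \<Rightarrow> bool) \<Rightarrow> bool"
    and \<alpha> \<beta> \<gamma> :: real
  assumes "gswf F" and "IIA F"
    and "choice_function F AltA AltB f"
    and "choice_function F AltB AltC g"
    and "choice_function F AltC AltA h"
    and "mono f" and "mono g" and "mono h"
    and "\<alpha> \<ge> 0" and "\<beta> \<ge> 0" and "\<gamma> \<ge> 0" and "\<alpha> + \<beta> + \<gamma> = 1/2"
    and "\<alpha> \<le> 1/4" and "\<beta> \<le> 1/4" and "\<gamma> \<le> 1/4"
  shows "irrational_prob \<alpha> \<beta> \<gamma> F \<le>
      uniform_mean f * uniform_mean g * uniform_mean h +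
      (1 - uniform_mean f) * (1 - uniform_mean g) * (1 - uniform_mean h)"
proof -
  define p where "p = map_pmf preference_of (pmf_of_list (even_triple_list \<alpha> \<beta> \<gamma>))"
  let ?M = "even_product \<alpha> \<beta> \<gamma> :: 'v profile pmf"
  let ?E = "measure_pmf.expectation ?M"
  define x y z :: "preference \<Rightarrow> bool"
    where "x = (\<lambda>R. (AltA, AltB) \<in> R)" "y = (\<lambda>R. (AltB, AltC) \<in> R)" "z = (\<lambda>R. (AltC, AltA) \<in> R)"
  note wf = even_triple_wf[OF assms(9-12)]
  have prob: "measure_pmf.prob p {R. Q R} =
      sum_list (map snd (filter (\<lambda>t. Q (preference_of (fst t))) (even_triple_list \<alpha> \<beta> \<gamma>)))" for Q
    by (simp add: p_def vimage_def measure_pmf_of_list[OF wf])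
  \<comment> \<open>Each of \<open>x\<close>, \<open>y\<close>, \<open>z\<close> is true on exactly
    three of the six triples, one of each weight, with total mass \<alpha> + \<beta> + \<gamma> =
    1/2.\<close>
  have fair: "map_pmf x p = pmf_of_set UNIV" "map_pmf y p = pmf_of_set UNIV"
    "map_pmf z p = pmf_of_set UNIV"
    using assms(12) by (intro map_pmf_eq_fair_coinI; simp add: prob even_triple_list_def x_y_z_def)+
  \<comment> \<open>Since (1,1,1) is excluded, two given bits are both 1 on a single triple: the
    three masses are \<alpha>, \<beta>, \<gamma> in this order.\<close>
  have neg: "measure_pmf.prob p {R. x R \<and> y R} \<le> 1/4"
    "measure_pmf.prob p {R. y R \<and> z R} \<le> 1/4" "measure_pmf.prob p {R. x R \<and> z R} \<le> 1/4"
    using assms(13-15) by (simp_all add: prob even_triple_list_def x_y_z_def)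
  have M: "?M = Pi_pmf UNIV undefined (\<lambda>_. p)"
    by (simp add: even_product_def p_def)
  define X Y Z :: "'v profile \<Rightarrow> real" where "X P = of_bool (f (x \<circ> P))"
    "Y P = of_bool (g (y \<circ> P))" "Z P = of_bool (h (z \<circ> P))" for P
  have mean: "?E X = uniform_mean f" "?E Y = uniform_mean g" "?E Z = uniform_mean h"
    unfolding M X_Y_Z_def by (simp_all only: expectation_fair_votes fair)
  have corr: "?E (\<lambda>P. X P * Y P) \<le> uniform_mean f * uniform_mean g"
    "?E (\<lambda>P. Y P * Z P) \<le> uniform_mean g * uniform_mean h"
    "?E (\<lambda>P. X P * Z P) \<le> uniform_mean f * uniform_mean h"
    unfolding M X_Y_Z_def by (intro expectation_fair_votes_mult_le fair neg assms)+
  have int: "integrable (measure_pmf ?M) X" "integrable (measure_pmf ?M) Y"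
    "integrable (measure_pmf ?M) Z" "integrable (measure_pmf ?M) (\<lambda>P. X P * Y P)"
    "integrable (measure_pmf ?M) (\<lambda>P. Y P * Z P)" "integrable (measure_pmf ?M) (\<lambda>P. X P * Z P)"
    by (auto intro!: measure_pmf.integrable_const_bound[of _ 1] simp: X_Y_Z_def)
  have "irrational_prob \<alpha> \<beta> \<gamma> F = ?E (indicator {P. irrational (F P)})"
    by (simp add: irrational_prob_def)
  \<comment> \<open>The integrand is \<open>X Y Z + (1 - X) (1 - Y) (1 - Z)\<close> expanded. It
    equals the indicator on \<open>profiles\<close>, which contains the support, so the equality
    holds almost everywhere.\<close>
  also have "\<dots> = ?E (\<lambda>P. 1 - X P - Y P - Z P + X P * Y P + Y P * Z P + X P * Z P)"
  proof (rule integral_cong_AE)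
    have "indicator {P. irrational (F P)} P =
        1 - X P - Y P - Z P + X P * Y P + Y P * Z P + X P * Z P" if "P \<in> set_pmf ?M" for P
    proof -
      have "P \<in> profiles"
        using that set_even_product[OF assms(9-12)] by blast
      from irrational_iff_choice[OF this assms(3-5)] show ?thesis
        by (auto simp: X_Y_Z_def x_y_z_def votes_def comp_def)
    qed
    then show "AE P in ?M. indicator {P. irrational (F P)} P =
        1 - X P - Y P - Z P + X P * Y P + Y P * Z P + X P * Z P"
      by (simp add: AE_measure_pmf_iff)
  qed simp_all
  also have "\<dots> = 1 - ?E X - ?E Y - ?E Z + ?E (\<lambda>P. X P * Y P) + ?E (\<lambda>P. Y P * Z P) + ?E (\<lambda>P. X P * Z P)"
    by (simp add: int)
  \<comment> \<open>The linear terms are known exactly and the quadratic ones have coefficient +1,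
    so the three upper bounds in \<open>corr\<close> suffice.\<close>
  also have "\<dots> \<le> 1 - uniform_mean f - uniform_mean g - uniform_mean h + uniform_mean f * uniform_mean g
      + uniform_mean g * uniform_mean h + uniform_mean f * uniform_mean h"
    unfolding mean using corr by linarith
  also have "\<dots> = uniform_mean f * uniform_mean g * uniform_mean h +
      (1 - uniform_mean f) * (1 - uniform_mean g) * (1 - uniform_mean h)"
    by (simp add: algebra_simps)
  finally show ?thesis .
qed

end
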